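(* Consider the DAE control system $$\tfrac{\rm d}{{\rm d}t}\mathcal{E}_r x_r=\mathcal{A}_r(x_r)\,x_r+\mathcal{B}_r u,\qquad y_r=-\tfrac{\rm d}{{\rm d}t}\mathcal{B}_r^T x_r+R^{-1}u,$$ with state $x_r=[a_1^T,\,a_{21}^T]^T\in\mathbb{R}^{n_r}$ and $$\mathcal{E}_r=\begin{bmatrix} M_{11}+X_1R^{-1}X_1^T & X_1R^{-1}X_2^T\hat{Y}_{C_2}\\ \hat{Y}_{C_2}^TX_2R^{-1}X_1^T & \hat{Y}_{C_2}^TX_2R^{-1}X_2^T\hat{Y}_{C_2}\end{bmatrix},\quad \mathcal{A}_r(x_r)=-\begin{bmatrix} K_{11}(a_1) & K_{12}\hat{Y}_{C_2}\\ \hat{Y}_{C_2}^TK_{21} & \hat{Y}_{C_2}^TK_{22}\hat{Y}_{C_2}\end{bmatrix},\quad \mathcal{B}_r=\begin{bmatrix} X_1\\ \hat{Y}_{C_2}^TX_2\end{bmatrix}R^{-1},$$ where $M_{11}$ and $M_\nu(C_d\,a)$ are symmetric and positive definite, $X_2$ has full column rank, and the columns of $\hat{Y}_{C_2}$ form a basis of $\mathrm{im}(C_2^T)$. This system has tractability index one.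
   Context: All spaces are real; $\|\cdot\|$ is the Euclidean norm. Domain and data. $\Omega\subset\mathbb{R}^3$ is a simply connected bounded Lipschitz domain, decomposed into a conducting subdomain $\Omega_C$ (connected, $\overline{\Omega}_C\subset\Omega$) and a non-conducting subdomain $\Omega_I=\Omega\setminus\overline{\Omega}_C$; $\Omega_I$ has finitely many connected internal subdomains with single boundary components $\Gamma_1,\ldots,\Gamma_q$ and an external subdomain $\Omega_{I,\rm ext}$ with two boundary components $\Gamma_{\rm ext}=\overline{\Omega}_{I,\rm ext}\cap\overline{\Omega}_C$ and $\partial\Omega$. The conductivity is $\sigma=\sigma_C\mathbb{1}_{\Omega_C}$ with $\sigma_C>0$. The reluctivity is $\nu(\xi,\zeta)=\nu_C(\zeta)\mathbb{1}_{\Omega_C}(\xi)+\nu_I\mathbb{1}_{\Omega_I}(\xi)$, where $\nu_I>0$ and $\nu_C:\mathbb{R}_{\ge0}\to\mathbb{R}_{\ge0}$ is measurable, and $\zeta\mapsto\nu_C(\zeta)\zeta$ is strongly monotone with constant $m_{\nu_C}>0$ and Lipschitz continuous with constant $L_{\nu_C}>0$. The resistance matrix $R\in\mathbb{R}^{m\times m}$ is symmetric positive definite. The winding function $\chi=[\chi_1,\ldots,\chi_m]$ has columns $\chi_j\in L^2(\Omega;\mathbb{R}^3)$ with $\nabla\cdot\chi_j=0$ and pairwise disjoint supports; $\gamma_j$ are functions with components in $H^1(\Omega)$ and $\chi_j=\nabla\times\gamma_j$. FEM matrices. $\varphi_1^e,\ldots,\varphi_{n_e}^e\in H_0(\mathrm{curl},\Omega)$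 are the edge (Nédélec, first type) basis functions and $\varphi_1^f,\ldots,\varphi_{n_f}^f$ the face basis functions of a regular simplicial triangulation of $\Omega$. $C_d\in\mathbb{R}^{n_f\times n_e}$ is the discrete curl matrix, with $(C_d)_{kj}=\pm1$ if edge $j$ belongs to face $k$ with the same/opposite orientation, and $0$ otherwise. For $a=[\alpha_1^e,\ldots,\alpha_{n_e}^e]^T$ put $(M_\sigma)_{kl}=\int_\Omega\sigma\,\varphi_l^e\cdot\varphi_k^e\,{\rm d}\xi$, $(K(a))_{kl}=\int_\Omega\nu(\xi,\|\nabla\times\sum_j\alpha_j^e\varphi_j^e\|)(\nabla\times\varphi_l^e)\cdot(\nabla\times\varphi_k^e)\,{\rm d}\xi$, $X_{kj}=\int_\Omega\chi_j\cdot\varphi_k^e\,{\rm d}\xi$. They factor as $K(a)=C_d^TM_\nu(C_d\,a)C_d$ and $X=C_d^T\Upsilon$, where, with $C_d\,a=[\alpha_1^f,\ldots,\alpha_{n_f}^f]^T$, $(M_\nu(C_d\,a))_{kl}=\int_\Omega\nu(\xi,\|\sum_j\alpha_j^f\varphi_j^f\|)\varphi_l^f\cdot\varphi_k^f\,{\rm d}\xi$ and $\Upsilon_{kj}=\int_\Omega\gamma_j\cdot\varphi_k^f\,{\rm d}\xi$; $M_\nu(C_d\,a)$ is symmetric positive definite for all $a$. Ordering the edge basis functions according to the conducting and non-conducting subdomains gives partitions $a=[a_1^T,a_2^T]^T$ with $a_1\in\mathbb{R}^{n_1}$, $a_2\in\mathbb{R}^{n_2}$, $n_e=n_1+n_2$,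 $C_d=[C_1\ C_2]$, and $$M_\sigma=\begin{bmatrix}M_{11}&0\\ 0&0\end{bmatrix},\quad K(a)=\begin{bmatrix}K_{11}(a_1)&K_{12}\\ K_{21}&K_{22}\end{bmatrix},\quad X=\begin{bmatrix}X_1\\ X_2\end{bmatrix}=\begin{bmatrix}C_1^T\Upsilon\\ C_2^T\Upsilon\end{bmatrix},$$ where only $K_{11}(a_1)$ depends on $a$ (through $a_1$), $K_{12}$, $K_{21}=K_{12}^T$, $K_{22}$ are constant, $M_{11}$ is symmetric positive definite, and $X_2\in\mathbb{R}^{n_2\times m}$ has full column rank. Let $k_2=\dim\ker(C_2)$; $\hat{Y}_{C_2}\in\mathbb{R}^{n_2\times(n_2-k_2)}$ and $n_r=n_1+n_2-k_2$. Tractability index one. Let $h(x_r)=\mathcal{A}_r(x_r)x_r$, let $\mathcal{J}_h(x_r)$ denote the Jacobian matrix of $h$ at $x_r$, and let $\mathcal{Q}$ be a projector onto $\ker(\mathcal{E}_r)$. The DAE system has tractability index one if $\mathcal{G}_1(x_r)=\mathcal{E}_r-\mathcal{J}_h(x_r)\mathcal{Q}$ is nonsingular for all $x_r$. *)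

theory Defs
  imports "HOL-Analysis.Analysis"
begin

section \<open>Matrices\<close>

definition spd :: "real^'n^'n \<Rightarrow> bool" where
  "spd A \<longleftrightarrow> transpose A = A \<and> (\<forall>x. x \<noteq> 0 \<longrightarrow> 0 < x \<bullet> (A *v x))"

definition submatrix :: "('k \<Rightarrow> 'i) \<Rightarrow> ('l \<Rightarrow> 'j) \<Rightarrow> real^'j^'i \<Rightarrow> real^'l^'k" where
  "submatrix f g A = (\<chi> k l. A $ f k $ g l)"

definition block_matrix ::
    "real^'c::finite^'a::finite \<Rightarrow> real^'d::finite^'a \<Rightarrow> real^'c^'b::finite \<Rightarrow> real^'d^'b \<Rightarrow>
     real^('c + 'd)^('a + 'b)" where
  "block_matrix A B C D = (\<chi> i j. case i of
      Inl a \<Rightarrow> (case j of Inl c \<Rightarrow> A $ a $ c | Inr d \<Rightarrow> B $ a $ d)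
    | Inr b \<Rightarrow> (case j of Inl c \<Rightarrow> C $ b $ c | Inr d \<Rightarrow> D $ b $ d))"

definition vstack :: "real^'m^'a::finite \<Rightarrow> real^'m^'b::finite \<Rightarrow> real^'m^('a + 'b)" where
  "vstack A B = (\<chi> i. case i of Inl a \<Rightarrow> A $ a | Inr b \<Rightarrow> B $ b)"

definition vec_append :: "real^'a::finite \<Rightarrow> real^'b::finite \<Rightarrow> real^('a + 'b)" where
  "vec_append v w = (\<chi> i. case i of Inl a \<Rightarrow> v $ a | Inr b \<Rightarrow> w $ b)"

definition vec_upper :: "real^('a::finite + 'b::finite) \<Rightarrow> real^'a" where
  "vec_upper v = (\<chi> i. v $ Inl i)"


section \<open>Differential operators and function spaces\<close>

definition partial_deriv :: "'n \<Rightarrow> (real^'n \<Rightarrow> real) \<Rightarrow> real^'n \<Rightarrow> real" where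
  "partial_deriv i f x = deriv (\<lambda>t. f (x + t *\<^sub>R axis i 1)) 0"

definition gradient :: "(real^'n \<Rightarrow> real) \<Rightarrow> real^'n \<Rightarrow> real^'n" where
  "gradient f x = (\<chi> i. partial_deriv i f x)"

definition curl :: "(real^3 \<Rightarrow> real^3) \<Rightarrow> real^3 \<Rightarrow> real^3" where
  "curl f x = vector
     [partial_deriv 2 (\<lambda>y. f y $ 3) x - partial_deriv 3 (\<lambda>y. f y $ 2) x,
      partial_deriv 3 (\<lambda>y. f y $ 1) x - partial_deriv 1 (\<lambda>y. f y $ 3) x,
      partial_deriv 1 (\<lambda>y. f y $ 2) x - partial_deriv 2 (\<lambda>y. f y $ 1) x]"

primrec Ck :: "nat \<Rightarrow> (real^'n \<Rightarrow> real) \<Rightarrow> bool" where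
  "Ck 0 f \<longleftrightarrow> continuous_on UNIV f"
| "Ck (Suc k) f \<longleftrightarrow> (\<forall>x. f differentiable (at x)) \<and> (\<forall>i. Ck k (partial_deriv i f))"

definition test_function :: "(real^'n) set \<Rightarrow> (real^'n \<Rightarrow> real) \<Rightarrow> bool" where
  "test_function \<Omega> \<eta> \<longleftrightarrow> (\<forall>k. Ck k \<eta>) \<and>
     compact (closure {x. \<eta> x \<noteq> 0}) \<and> closure {x. \<eta> x \<noteq> 0} \<subseteq> \<Omega>"

definition test_field :: "(real^3) set \<Rightarrow> (real^3 \<Rightarrow> real^3) \<Rightarrow> bool" where
  "test_field \<Omega> \<eta> \<longleftrightarrow> (\<forall>i. test_function \<Omega> (\<lambda>x. \<eta> x $ i))"

definition L2 :: "(real^3) set \<Rightarrow> (real^3 \<Rightarrow> 'a::euclidean_space) \<Rightarrow> bool" where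
  "L2 \<Omega> f \<longleftrightarrow> f \<in> borel_measurable (lebesgue_on \<Omega>) \<and>
     integrable (lebesgue_on \<Omega>) (\<lambda>x. (norm (f x))\<^sup>2)"

definition H1 :: "(real^3) set \<Rightarrow> (real^3 \<Rightarrow> real) \<Rightarrow> bool" where
  "H1 \<Omega> u \<longleftrightarrow> L2 \<Omega> u \<and> (\<forall>i. \<exists>v. L2 \<Omega> v \<and> (\<forall>\<eta>. test_function \<Omega> \<eta> \<longrightarrow>
     (LINT x|lebesgue_on \<Omega>. u x * partial_deriv i \<eta> x) = - (LINT x|lebesgue_on \<Omega>. v x * \<eta> x)))"

definition weakly_div_free :: "(real^3) set \<Rightarrow> (real^3 \<Rightarrow> real^3) \<Rightarrow> bool" where
  "weakly_div_free \<Omega> f \<longleftrightarrow>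
     (\<forall>\<eta>. test_function \<Omega> \<eta> \<longrightarrow> (LINT x|lebesgue_on \<Omega>. f x \<bullet> gradient \<eta> x) = 0)"

definition has_weak_curl :: "(real^3) set \<Rightarrow> (real^3 \<Rightarrow> real^3) \<Rightarrow> (real^3 \<Rightarrow> real^3) \<Rightarrow> bool" where
  "has_weak_curl \<Omega> f g \<longleftrightarrow> (\<forall>\<eta>. test_field \<Omega> \<eta> \<longrightarrow>
     (LINT x|lebesgue_on \<Omega>. f x \<bullet> curl \<eta> x) = (LINT x|lebesgue_on \<Omega>. g x \<bullet> \<eta> x))"

text \<open>\<open>H\<^sub>0(curl, \<Omega>)\<close>: the closure of the test fields in \<open>H(curl, \<Omega>)\<close>.  Since \<open>f\<close> and \<open>g\<close> are
  \<open>L\<^sup>2\<close> limits of \<open>\<eta> n\<close> and \<open>curl (\<eta> n)\<close>, the field \<open>g\<close> is the weak curl of \<open>f\<close>.\<close>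

definition H0_curl :: "(real^3) set \<Rightarrow> (real^3 \<Rightarrow> real^3) \<Rightarrow> bool" where
  "H0_curl \<Omega> f \<longleftrightarrow> L2 \<Omega> f \<and> (\<exists>g \<eta>. L2 \<Omega> g \<and> (\<forall>n::nat. test_field \<Omega> (\<eta> n)) \<and>
     (\<lambda>n. LINT x|lebesgue_on \<Omega>. (norm (\<eta> n x - f x))\<^sup>2) \<longlonglongrightarrow> 0 \<and>
     (\<lambda>n. LINT x|lebesgue_on \<Omega>. (norm (curl (\<eta> n) x - g x))\<^sup>2) \<longlonglongrightarrow> 0)"

definition ess_support :: "(real^3) set \<Rightarrow> (real^3 \<Rightarrow> real^3) \<Rightarrow> (real^3) set" where
  "ess_support \<Omega> f = {x \<in> \<Omega>. \<forall>e>0. \<not> (AE y in lebesgue_on (ball x e \<inter> \<Omega>). f y = 0)}"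


section \<open>The domain\<close>

text \<open>Near each boundary point, the domain is the part above the graph of a Lipschitz function
  defined on a plane with unit normal \<open>n\<close>.\<close>

definition lipschitz_boundary :: "(real^3) set \<Rightarrow> bool" where
  "lipschitz_boundary \<Omega> \<longleftrightarrow> (\<forall>x0 \<in> frontier \<Omega>. \<exists>U n L g.
     open U \<and> x0 \<in> U \<and> norm n = 1 \<and> L-lipschitz_on {y. y \<bullet> n = 0} g \<and>
     \<Omega> \<inter> U = {x \<in> U. g (x - (x \<bullet> n) *\<^sub>R n) < x \<bullet> n})"

definition mqs_domain :: "(real^3) set \<Rightarrow> (real^3) set \<Rightarrow> bool" where
  "mqs_domain \<Omega> \<Omega>C \<longleftrightarrow>
     open \<Omega> \<and> connected \<Omega> \<and> \<Omega> \<noteq> {} \<and> bounded \<Omega> \<and> simply_connected \<Omega> \<and> lipschitz_boundary \<Omega> \<and>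
     open \<Omega>C \<and> connected \<Omega>C \<and> \<Omega>C \<noteq> {} \<and> closure \<Omega>C \<subseteq> \<Omega> \<and>
     finite (components (\<Omega> - closure \<Omega>C)) \<and>
     (\<exists>\<Omega>ext \<in> components (\<Omega> - closure \<Omega>C).
        components (frontier \<Omega>ext) = {closure \<Omega>ext \<inter> closure \<Omega>C, frontier \<Omega>} \<and>
        (\<forall>D \<in> components (\<Omega> - closure \<Omega>C) - {\<Omega>ext}. connected (frontier D)))"


section \<open>Lowest-order edge and face elements\<close>

definition vertices :: "(real^3) set \<Rightarrow> (real^3) set" where
  "vertices T = {v. v extreme_point_of T}"

text \<open>Gradient of the barycentric coordinate of the tetrahedron \<open>T\<close> that is \<open>1\<close> at the vertex \<open>p\<close>
  and \<open>0\<close> at the other three vertices.\<close>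

definition bary_grad :: "(real^3) set \<Rightarrow> real^3 \<Rightarrow> real^3" where
  "bary_grad T p = (THE g. \<exists>c. \<forall>v \<in> vertices T. g \<bullet> v + c = of_bool (v = p))"

definition bary :: "(real^3) set \<Rightarrow> real^3 \<Rightarrow> real^3 \<Rightarrow> real" where
  "bary T p x = 1 + bary_grad T p \<bullet> (x - p)"

text \<open>The oriented edge \<open>p \<rightarrow> q\<close> and the oriented face \<open>(p, q, r)\<close> carry the Whitney functions,
  normalised to circulation, respectively flux, \<open>1\<close>.  They only matter almost
  everywhere; on the faces of the mesh, a null set, they are given the value \<open>0\<close>.\<close>

definition edge_function :: "(real^3) set set \<Rightarrow> (real^3) \<times> (real^3) \<Rightarrow> real^3 \<Rightarrow> real^3" where
  "edge_function \<T> = (\<lambda>(p, q) x. \<Sum>T | T \<in> \<T> \<and> {p, q} \<subseteq> vertices T. indicat_real (interior T) x *\<^sub>R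
     (bary T p x *\<^sub>R bary_grad T q - bary T q x *\<^sub>R bary_grad T p))"

definition face_function ::
    "(real^3) set set \<Rightarrow> (real^3) \<times> (real^3) \<times> (real^3) \<Rightarrow> real^3 \<Rightarrow> real^3" where
  "face_function \<T> = (\<lambda>(p, q, r) x.
     \<Sum>T | T \<in> \<T> \<and> {p, q, r} \<subseteq> vertices T. indicat_real (interior T) x *\<^sub>R (2 *\<^sub>R
       (bary T p x *\<^sub>R cross3 (bary_grad T q) (bary_grad T r) +
        bary T q x *\<^sub>R cross3 (bary_grad T r) (bary_grad T p) +
        bary T r x *\<^sub>R cross3 (bary_grad T p) (bary_grad T q))))"


section \<open>The finite element data\<close>

text \<open>The index types of the edges (conducting, \<open>'n1\<close>, and non-conducting, \<open>'n2\<close>), of the faces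
  \<open>'nf\<close> and of the windings \<open>'m\<close> are finite, so that \<open>real^'n1\<close> is the space of vectors with
  \<open>n\<^sub>1 = CARD('n1)\<close> components, and so on.  \<open>edge\<close> and \<open>face\<close> list the oriented edges and faces
  that carry basis functions.\<close>

record ('n1::finite, 'n2::finite, 'nf::finite, 'm::finite) mqs =
  Om :: "(real^3) set"
  OmC :: "(real^3) set"
  sigmaC :: real
  nuC :: "real \<Rightarrow> real"
  nuI :: real
  Res :: "real^'m^'m"
  wind :: "'m \<Rightarrow> real^3 \<Rightarrow> real^3"
  wpot :: "'m \<Rightarrow> real^3 \<Rightarrow> real^3"
  mesh :: "(real^3) set set"
  edge :: "'n1 + 'n2 \<Rightarrow> (real^3) \<times> (real^3)"
  face :: "'nf \<Rightarrow> (real^3) \<times> (real^3) \<times> (real^3)"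

definition OmI :: "('n1::finite, 'n2::finite, 'nf::finite, 'm::finite) mqs \<Rightarrow> (real^3) set" where
  "OmI P = Om P - closure (OmC P)"

definition edge_set :: "(real^3) \<times> (real^3) \<Rightarrow> (real^3) set" where
  "edge_set = (\<lambda>(p, q). {p, q})"

definition face_set :: "(real^3) \<times> (real^3) \<times> (real^3) \<Rightarrow> (real^3) set" where
  "face_set = (\<lambda>(p, q, r). {p, q, r})"

text \<open>An edge is conducting if its basis function does not vanish on the conductor, that is, if it
  is an edge of a tetrahedron in the conductor; edges on the interface are conducting.\<close>

definition mqs_mesh :: "('n1::finite, 'n2::finite, 'nf::finite, 'm::finite) mqs \<Rightarrow> bool" where
  "mqs_mesh P \<longleftrightarrow>
     triangulation (mesh P) \<and> (\<forall>T \<in> mesh P. 3 simplex T) \<and> \<Union>(mesh P) = closure (Om P) \<and>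
     (\<forall>T \<in> mesh P. interior T \<subseteq> OmC P \<or> interior T \<subseteq> OmI P) \<and>
     bij_betw (\<lambda>j. edge_set (edge P j)) UNIV
       {S. \<exists>p q. S = {p, q} \<and> p \<noteq> q \<and> (\<exists>T \<in> mesh P. {p, q} \<subseteq> vertices T) \<and>
           H0_curl (Om P) (edge_function (mesh P) (p, q))} \<and>
     (\<forall>j. (\<exists>T \<in> mesh P. interior T \<subseteq> OmC P \<and> edge_set (edge P j) \<subseteq> vertices T) \<longleftrightarrow> j \<in> range Inl) \<and>
     bij_betw (\<lambda>k. face_set (face P k)) UNIV {S. card S = 3 \<and> (\<exists>T \<in> mesh P. S \<subseteq> vertices T)}"

definition strongly_monotone_on :: "real set \<Rightarrow> real \<Rightarrow> (real \<Rightarrow> real) \<Rightarrow> bool" where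
  "strongly_monotone_on S m f \<longleftrightarrow> (\<forall>x \<in> S. \<forall>y \<in> S. m * (x - y)\<^sup>2 \<le> (f x - f y) * (x - y))"

definition mqs_coefficients :: "('n1::finite, 'n2::finite, 'nf::finite, 'm::finite) mqs \<Rightarrow> bool" where
  "mqs_coefficients P \<longleftrightarrow>
     0 < sigmaC P \<and> 0 < nuI P \<and>
     nuC P \<in> borel_measurable (restrict_space borel {0..}) \<and> (\<forall>\<zeta>\<ge>0. 0 \<le> nuC P \<zeta>) \<and>
     (\<exists>m>0. strongly_monotone_on {0..} m (\<lambda>\<zeta>. nuC P \<zeta> * \<zeta>)) \<and>
     (\<exists>L>0. L-lipschitz_on {0..} (\<lambda>\<zeta>. nuC P \<zeta> * \<zeta>)) \<and>
     spd (Res P)"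

definition mqs_winding :: "('n1::finite, 'n2::finite, 'nf::finite, 'm::finite) mqs \<Rightarrow> bool" where
  "mqs_winding P \<longleftrightarrow>
     (\<forall>j. L2 (Om P) (wind P j) \<and> weakly_div_free (Om P) (wind P j) \<and>
          (\<forall>i. H1 (Om P) (\<lambda>x. wpot P j x $ i)) \<and> has_weak_curl (Om P) (wpot P j) (wind P j)) \<and>
     (\<forall>i j. i \<noteq> j \<longrightarrow> ess_support (Om P) (wind P i) \<inter> ess_support (Om P) (wind P j) = {})"

definition mqs_setting :: "('n1::finite, 'n2::finite, 'nf::finite, 'm::finite) mqs \<Rightarrow> bool" where
  "mqs_setting P \<longleftrightarrow>
     mqs_domain (Om P) (OmC P) \<and> mqs_coefficients P \<and> mqs_winding P \<and> mqs_mesh P"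

definition sigma :: "('n1::finite, 'n2::finite, 'nf::finite, 'm::finite) mqs \<Rightarrow> real^3 \<Rightarrow> real" where
  "sigma P \<xi> = sigmaC P * indicat_real (OmC P) \<xi>"

definition nu :: "('n1::finite, 'n2::finite, 'nf::finite, 'm::finite) mqs \<Rightarrow> real^3 \<Rightarrow> real \<Rightarrow> real" where
  "nu P \<xi> \<zeta> = nuC P \<zeta> * indicat_real (OmC P) \<xi> + nuI P * indicat_real (OmI P) \<xi>"

definition phi_e ::
    "('n1::finite, 'n2::finite, 'nf::finite, 'm::finite) mqs \<Rightarrow> 'n1 + 'n2 \<Rightarrow> real^3 \<Rightarrow> real^3" where
  "phi_e P j = edge_function (mesh P) (edge P j)"

definition phi_f ::
    "('n1::finite, 'n2::finite, 'nf::finite, 'm::finite) mqs \<Rightarrow> 'nf \<Rightarrow> real^3 \<Rightarrow> real^3" where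
  "phi_f P k = face_function (mesh P) (face P k)"


section \<open>Finite element matrices\<close>

definition incidence :: "(real^3) \<times> (real^3) \<times> (real^3) \<Rightarrow> (real^3) \<times> (real^3) \<Rightarrow> real" where
  "incidence = (\<lambda>(a, b, c) (p, q).
     if (p, q) \<in> {(a, b), (b, c), (c, a)} then 1
     else if (q, p) \<in> {(a, b), (b, c), (c, a)} then -1 else 0)"

definition C_d :: "('n1::finite, 'n2::finite, 'nf::finite, 'm::finite) mqs \<Rightarrow> real^('n1 + 'n2)^'nf" where
  "C_d P = (\<chi> k j. incidence (face P k) (edge P j))"

definition C_2 :: "('n1::finite, 'n2::finite, 'nf::finite, 'm::finite) mqs \<Rightarrow> real^'n2^'nf" where
  "C_2 P = submatrix id Inr (C_d P)"

definition M_sigma ::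
    "('n1::finite, 'n2::finite, 'nf::finite, 'm::finite) mqs \<Rightarrow> real^('n1 + 'n2)^('n1 + 'n2)" where
  "M_sigma P = (\<chi> k l. LINT \<xi>|lebesgue_on (Om P). sigma P \<xi> * (phi_e P l \<xi> \<bullet> phi_e P k \<xi>))"

text \<open>The classical curl of an edge function exists off the faces of the mesh and agrees almost
  everywhere with its weak curl.\<close>

definition stiffness :: "('n1::finite, 'n2::finite, 'nf::finite, 'm::finite) mqs \<Rightarrow>
    real^('n1 + 'n2) \<Rightarrow> real^('n1 + 'n2)^('n1 + 'n2)" where
  "stiffness P a = (\<chi> k l. LINT \<xi>|lebesgue_on (Om P).
     nu P \<xi> (norm (curl (\<lambda>x. \<Sum>j\<in>UNIV. a $ j *\<^sub>R phi_e P j x) \<xi>)) *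
     (curl (phi_e P l) \<xi> \<bullet> curl (phi_e P k) \<xi>))"

definition M_nu :: "('n1::finite, 'n2::finite, 'nf::finite, 'm::finite) mqs \<Rightarrow>
    real^'nf \<Rightarrow> real^'nf^'nf" where
  "M_nu P b = (\<chi> k l. LINT \<xi>|lebesgue_on (Om P).
     nu P \<xi> (norm (\<Sum>j\<in>UNIV. b $ j *\<^sub>R phi_f P j \<xi>)) * (phi_f P l \<xi> \<bullet> phi_f P k \<xi>))"

definition coupling :: "('n1::finite, 'n2::finite, 'nf::finite, 'm::finite) mqs \<Rightarrow> real^'m^('n1 + 'n2)" where
  "coupling P = (\<chi> k j. LINT \<xi>|lebesgue_on (Om P). wind P j \<xi> \<bullet> phi_e P k \<xi>)"

definition M_11 :: "('n1::finite, 'n2::finite, 'nf::finite, 'm::finite) mqs \<Rightarrow> real^'n1^'n1" where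
  "M_11 P = submatrix Inl Inl (M_sigma P)"

definition X_1 :: "('n1::finite, 'n2::finite, 'nf::finite, 'm::finite) mqs \<Rightarrow> real^'m^'n1" where
  "X_1 P = submatrix Inl id (coupling P)"

definition X_2 :: "('n1::finite, 'n2::finite, 'nf::finite, 'm::finite) mqs \<Rightarrow> real^'m^'n2" where
  "X_2 P = submatrix Inr id (coupling P)"

text \<open>The blocks of the stiffness matrix are read off at \<open>[a\<^sub>1, 0]\<close> and at \<open>0\<close>; the lemma
  \<open>stiffness_blocks\<close> below shows that they are the blocks at every \<open>a\<close>.\<close>

definition K_11 :: "('n1::finite, 'n2::finite, 'nf::finite, 'm::finite) mqs \<Rightarrow> real^'n1 \<Rightarrow> real^'n1^'n1" where
  "K_11 P a1 = submatrix Inl Inl (stiffness P (vec_append a1 0))"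

definition K_12 :: "('n1::finite, 'n2::finite, 'nf::finite, 'm::finite) mqs \<Rightarrow> real^'n2^'n1" where
  "K_12 P = submatrix Inl Inr (stiffness P 0)"

definition K_21 :: "('n1::finite, 'n2::finite, 'nf::finite, 'm::finite) mqs \<Rightarrow> real^'n1^'n2" where
  "K_21 P = submatrix Inr Inl (stiffness P 0)"

definition K_22 :: "('n1::finite, 'n2::finite, 'nf::finite, 'm::finite) mqs \<Rightarrow> real^'n2^'n2" where
  "K_22 P = submatrix Inr Inr (stiffness P 0)"


section \<open>The block structure\<close>

lemma lebesgue_on_integral_cong:
  fixes f g :: "real^3 \<Rightarrow> real"
  assumes S: "open S" and N: "negligible N" and eq: "\<And>x. x \<in> S - N \<Longrightarrow> f x = g x"
  shows "integral\<^sup>L (lebesgue_on S) f = integral\<^sup>L (lebesgue_on S) g"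
proof -
  let ?f = "\<lambda>x. indicat_real S x *\<^sub>R f x" and ?g = "\<lambda>x. indicat_real S x *\<^sub>R g x"
  have ae: "AE x in lebesgue. ?f x = ?g x"
    by (rule AE_I'[of N]) (use N eq in \<open>auto simp: negligible_iff_null_sets indicator_def\<close>)
  have ae': "AE x in lebesgue. ?g x = ?f x"
    using ae by eventually_elim (rule sym)
  have "integral\<^sup>L lebesgue ?f = integral\<^sup>L lebesgue ?g"
  proof (cases "?f \<in> borel_measurable lebesgue")
    case True
    from borel_measurable_AE[OF this ae] have "?g \<in> borel_measurable lebesgue" .
    from integral_cong_AE[OF True this ae] show ?thesis .
  next
    case False
    have "?g \<notin> borel_measurable lebesgue"
      using False borel_measurable_AE[OF _ ae'] by (rule contrapos_nn)
    then have "\<not> integrable lebesgue ?g" "\<not> integrable lebesgue ?f"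
      using False borel_measurable_integrable[of lebesgue ?f] borel_measurable_integrable[of lebesgue ?g]
      by argo+
    then show ?thesis
      using not_integrable_integral_eq[of lebesgue ?f] not_integrable_integral_eq[of lebesgue ?g]
      by argo
  qed
  moreover have "S \<inter> space lebesgue \<in> sets lebesgue"
    using S by auto
  ultimately show ?thesis
    by (simp add: integral_restrict_space)
qed

lemma curl_cong_open:
  assumes S: "open S" "x \<in> S" and eq: "\<And>y. y \<in> S \<Longrightarrow> f y = g y"
  shows "curl f x = curl g x"
proof -
  have "partial_deriv i (\<lambda>y. f y $ k) x = partial_deriv i (\<lambda>y. g y $ k) x" for i k
    unfolding partial_deriv_def
  proof (rule deriv_cong_ev)
    have "continuous_on UNIV (\<lambda>t::real. x + t *\<^sub>R axis i (1::real))"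
      by (intro continuous_intros)
    then have "open ((\<lambda>t::real. x + t *\<^sub>R axis i (1::real)) -` S)"
      using S by (simp add: open_vimage)
    then have "\<forall>\<^sub>F t in nhds 0. t \<in> (\<lambda>t::real. x + t *\<^sub>R axis i (1::real)) -` S"
      by (rule eventually_nhds_in_open) (use S in simp)
    then show "\<forall>\<^sub>F t in nhds 0. f (x + t *\<^sub>R axis i 1) $ k = g (x + t *\<^sub>R axis i 1) $ k"
      by eventually_elim (simp add: eq)
  qed simp
  then show ?thesis
    by (simp add: curl_def)
qed

lemma curl_zero [simp]: "curl (\<lambda>x. 0) x = 0"
  by (simp add: curl_def partial_deriv_def vec_eq_iff forall_3)

definition skeleton :: "(real^3) set set \<Rightarrow> (real^3) set" where
  "skeleton \<T> = (\<Union>T\<in>\<T>. frontier T)"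

context
  fixes P :: "('n1::finite, 'n2::finite, 'nf::finite, 'm::finite) mqs"
  assumes P: "mqs_setting P"
begin

lemma mesh_facts:
  shows "open (Om P)" and "OmC P \<subseteq> closure (OmC P)" and "finite (mesh P)"
    and "\<And>T. T \<in> mesh P \<Longrightarrow> 3 simplex T"
    and "\<And>T T'. T \<in> mesh P \<Longrightarrow> T' \<in> mesh P \<Longrightarrow> (T \<inter> T') face_of T"
    and "\<And>T. T \<in> mesh P \<Longrightarrow> interior T \<subseteq> OmC P \<or> interior T \<subseteq> OmI P"
    and "Om P \<subseteq> \<Union>(mesh P)"
proof -
  have d: "mqs_domain (Om P) (OmC P)" and m: "mqs_mesh P"
    using P by (simp_all add: mqs_setting_def)
  show "open (Om P)"
    using d unfolding mqs_domain_def by (elim conjE)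
  have t: "triangulation (mesh P)"
    using m unfolding mqs_mesh_def by (elim conjE)
  have s: "\<forall>T \<in> mesh P. 3 simplex T"
    using m unfolding mqs_mesh_def by (elim conjE)
  have u: "\<Union>(mesh P) = closure (Om P)"
    using m unfolding mqs_mesh_def by (elim conjE)
  have i: "\<forall>T \<in> mesh P. interior T \<subseteq> OmC P \<or> interior T \<subseteq> OmI P"
    using m unfolding mqs_mesh_def by (elim conjE)
  show "OmC P \<subseteq> closure (OmC P)" "Om P \<subseteq> \<Union>(mesh P)"
    unfolding u by (rule closure_subset)+
  show "finite (mesh P)" "\<And>T T'. T \<in> mesh P \<Longrightarrow> T' \<in> mesh P \<Longrightarrow> (T \<inter> T') face_of T"
    using t unfolding triangulation_def by blast+
  show "\<And>T. T \<in> mesh P \<Longrightarrow> 3 simplex T"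
    "\<And>T. T \<in> mesh P \<Longrightarrow> interior T \<subseteq> OmC P \<or> interior T \<subseteq> OmI P"
    using s i by blast+
qed

lemma conducting_iff:
  "(\<exists>T \<in> mesh P. interior T \<subseteq> OmC P \<and> edge_set (edge P j) \<subseteq> vertices T) \<longleftrightarrow> j \<in> range Inl"
proof -
  have "mqs_mesh P"
    using P by (simp add: mqs_setting_def)
  then show ?thesis
    unfolding mqs_mesh_def by (elim conjE) (erule allE, assumption)
qed

lemma negligible_skeleton: "negligible (skeleton (mesh P))"
  unfolding skeleton_def
  using mesh_facts(3,4) by (auto intro!: negligible_Union negligible_convex_frontier convex_simplex)

lemma in_interior:
  assumes "x \<in> Om P - skeleton (mesh P)"
  obtains T where "T \<in> mesh P" "x \<in> interior T"
proof -
  obtain T where T: "T \<in> mesh P" "x \<in> T"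
    using assms mesh_facts(7) by blast
  then have "x \<in> interior T"
    using assms closure_subset[of T] by (auto simp: skeleton_def frontier_def)
  with T that show thesis by blast
qed

lemma interior_unique:
  assumes "T \<in> mesh P" "T' \<in> mesh P" "x \<in> interior T" "x \<in> interior T'"
  shows "T = T'"
proof -
  have "T \<subseteq> T'" if T: "T \<in> mesh P" "T' \<in> mesh P" and x: "x \<in> interior T" "x \<in> interior T'" for T T'
  proof -
    have "x \<in> rel_interior T"
      using x interior_subset_rel_interior by blast
    then have "T \<subseteq> T \<inter> T'"
      using subset_of_face_of[OF mesh_facts(5)[OF T], of T] x interior_subset by blast
    then show ?thesis by blast
  qed
  then show ?thesis using assms by blast
qed

lemma phi_e_Inr_conductor:
  assumes T: "T \<in> mesh P" "x \<in> interior T" and x: "x \<in> OmC P"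
  shows "phi_e P (Inr l) x = 0"
proof -
  have "interior T \<subseteq> OmC P"
    using mesh_facts(6)[OF T(1)] T(2) x mesh_facts(2) by (auto simp: OmI_def)
  then have "\<not> edge_set (edge P (Inr l)) \<subseteq> vertices T"
    using conducting_iff T(1) by (metis Inl_Inr_False rangeE)
  moreover obtain p q where e: "edge P (Inr l) = (p, q)"
    by fastforce
  ultimately have nv: "\<not> {p, q} \<subseteq> vertices T"
    by (simp add: edge_set_def)
  have "x \<notin> interior T'" if "T' \<in> mesh P" "{p, q} \<subseteq> vertices T'" for T'
    using interior_unique[OF T(1) that(1) T(2)] that nv by blast
  then have "(\<Sum>T | T \<in> mesh P \<and> {p, q} \<subseteq> vertices T. indicat_real (interior T) x *\<^sub>R
     (bary T p x *\<^sub>R bary_grad T q - bary T q x *\<^sub>R bary_grad T p)) = 0"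
    by (intro sum.neutral) auto
  then show ?thesis
    by (simp add: phi_e_def edge_function_def e)
qed

lemma interior_conductor:
  assumes "T \<in> mesh P" "x \<in> interior T" "x \<in> OmC P" "y \<in> interior T"
  shows "y \<in> OmC P"
  using mesh_facts(6)[OF assms(1)] assms mesh_facts(2) by (auto simp: OmI_def)

lemma curl_Inr_conductor:
  assumes "T \<in> mesh P" "x \<in> interior T" "x \<in> OmC P"
  shows "curl (phi_e P (Inr l)) x = 0"
proof -
  have "curl (phi_e P (Inr l)) x = curl (\<lambda>x. 0) x"
    by (rule curl_cong_open[OF open_interior assms(2)])
      (rule phi_e_Inr_conductor[OF assms(1) _ interior_conductor[OF assms]])
  then show ?thesis by simp
qed

lemma curl_sum_conductor:
  assumes T: "T \<in> mesh P" "x \<in> interior T" "x \<in> OmC P" and ab: "vec_upper a = vec_upper b"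
  shows "curl (\<lambda>x. \<Sum>j\<in>UNIV. a $ j *\<^sub>R phi_e P j x) x = curl (\<lambda>x. \<Sum>j\<in>UNIV. b $ j *\<^sub>R phi_e P j x) x"
proof (rule curl_cong_open[OF open_interior T(2)])
  fix y assume y: "y \<in> interior T"
  have "a $ j *\<^sub>R phi_e P j y = b $ j *\<^sub>R phi_e P j y" for j
  proof (cases j)
    case (Inl i)
    then show ?thesis using ab by (simp add: vec_upper_def vec_eq_iff)
  next
    case (Inr i)
    then show ?thesis
      using phi_e_Inr_conductor[OF T(1) y] interior_conductor[OF T y] by simp
  qed
  then show "(\<Sum>j\<in>UNIV. a $ j *\<^sub>R phi_e P j y) = (\<Sum>j\<in>UNIV. b $ j *\<^sub>R phi_e P j y)"
    by (rule sum.cong[OF refl])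
qed

lemma stiffness_entry_cong:
  assumes "vec_upper a = vec_upper b \<or> k \<in> range Inr \<or> l \<in> range Inr"
  shows "stiffness P a $ k $ l = stiffness P b $ k $ l"
  unfolding stiffness_def vec_lambda_beta
proof (rule lebesgue_on_integral_cong[OF mesh_facts(1) negligible_skeleton])
  fix x assume x: "x \<in> Om P - skeleton (mesh P)"
  then obtain T where T: "T \<in> mesh P" "x \<in> interior T"
    using in_interior by blast
  show "nu P x (norm (curl (\<lambda>x. \<Sum>j\<in>UNIV. a $ j *\<^sub>R phi_e P j x) x)) *
      (curl (phi_e P l) x \<bullet> curl (phi_e P k) x) =
    nu P x (norm (curl (\<lambda>x. \<Sum>j\<in>UNIV. b $ j *\<^sub>R phi_e P j x) x)) *
      (curl (phi_e P l) x \<bullet> curl (phi_e P k) x)"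
  proof (cases "x \<in> OmC P")
    case True
    show ?thesis
      using assms curl_sum_conductor[OF T True, of a b] curl_Inr_conductor[OF T True] by auto
  next
    case False
    then show ?thesis by (simp add: nu_def)
  qed
qed

lemma stiffness_blocks:
  "stiffness P (vec_append a1 a2) = block_matrix (K_11 P a1) (K_12 P) (K_21 P) (K_22 P)"
proof -
  have 1: "stiffness P (vec_append a1 a2) $ Inl i $ Inl j = stiffness P (vec_append a1 0) $ Inl i $ Inl j"
    for i j by (rule stiffness_entry_cong) (simp add: vec_upper_def vec_append_def)
  have 2: "stiffness P (vec_append a1 a2) $ k $ l = stiffness P 0 $ k $ l"
    if "k \<in> range Inr \<or> l \<in> range Inr" for k l
    using that by (intro stiffness_entry_cong) simp
  have "stiffness P (vec_append a1 a2) $ k $ l =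
    block_matrix (K_11 P a1) (K_12 P) (K_21 P) (K_22 P) $ k $ l" for k l
    by (cases k; cases l)
      (simp_all add: block_matrix_def K_11_def K_12_def K_21_def K_22_def submatrix_def 1 2)
  then show ?thesis
    by (simp add: vec_eq_iff)
qed

lemma M_sigma_blocks: "M_sigma P = block_matrix (M_11 P) 0 0 0"
proof -
  have "M_sigma P $ k $ l = 0" if "k \<in> range Inr \<or> l \<in> range Inr" for k l
  proof -
    have "M_sigma P $ k $ l = (LINT \<xi>|lebesgue_on (Om P). 0)"
      unfolding M_sigma_def vec_lambda_beta
    proof (rule lebesgue_on_integral_cong[OF mesh_facts(1) negligible_skeleton])
      fix x assume "x \<in> Om P - skeleton (mesh P)"
      then obtain T where T: "T \<in> mesh P" "x \<in> interior T"
        using in_interior by blast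
      show "sigma P x * (phi_e P l x \<bullet> phi_e P k x) = 0"
        using that phi_e_Inr_conductor[OF T] by (auto simp: sigma_def indicator_def)
    qed
    then show ?thesis by simp
  qed
  then have "M_sigma P $ k $ l = block_matrix (M_11 P) 0 0 0 $ k $ l" for k l
    by (cases k; cases l) (simp_all add: block_matrix_def M_11_def submatrix_def)
  then show ?thesis
    by (simp add: vec_eq_iff)
qed

end


section \<open>DAE control systems and tractability index one\<close>

text \<open>The record stands for the system
  \<open>d/dt E x = A(x) x + B u\<close>, \<open>y = - d/dt B\<^sup>T x + D u\<close>.\<close>

record ('n::finite, 'm::finite) dae_system =
  dae_E :: "real^'n^'n"
  dae_A :: "real^'n \<Rightarrow> real^'n^'n"
  dae_B :: "real^'m^'n"
  dae_D :: "real^'m^'m"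

text \<open>The matrix of partial derivatives; \<open>jacobian_matrix_eq_jacobian\<close> below shows that it is
  the library's \<open>jacobian\<close> wherever the function is differentiable.  Since \<open>\<nu>\<^sub>C(\<zeta>) \<zeta>\<close> is merely
  Lipschitz continuous, \<open>A(x) x\<close> need not be differentiable everywhere.  An entry whose partial
  derivative does not exist is an unspecified real number.\<close>

definition jacobian_matrix :: "(real^'n \<Rightarrow> real^'k) \<Rightarrow> real^'n \<Rightarrow> real^'n^'k" where
  "jacobian_matrix h x = (\<chi> i j. partial_deriv j (\<lambda>y. h y $ i) x)"

lemma jacobian_matrix_eq_jacobian:
  fixes h :: "real^'n \<Rightarrow> real^'k"
  assumes "h differentiable (at x)"
  shows "jacobian_matrix h x = jacobian h (at x)"
proof -
  have D: "(h has_derivative (\<lambda>v. jacobian h (at x) *v v)) (at x)"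
    using assms jacobian_works by blast
  have "partial_deriv j (\<lambda>y. h y $ i) x = jacobian h (at x) $ i $ j" for i j
  proof -
    have l: "((\<lambda>t::real. x + t *\<^sub>R axis j 1) has_derivative (\<lambda>t. t *\<^sub>R axis j 1)) (at 0)"
      by (auto intro!: derivative_eq_intros)
    have "((\<lambda>t::real. h (x + t *\<^sub>R axis j 1)) has_derivative
        (\<lambda>t. jacobian h (at x) *v (t *\<^sub>R axis j 1))) (at 0)"
      using has_derivative_compose[OF l, of h "\<lambda>v. jacobian h (at x) *v v"] D by simp
    then have "((\<lambda>t::real. h (x + t *\<^sub>R axis j 1) $ i) has_derivative
        (\<lambda>t. (jacobian h (at x) *v (t *\<^sub>R axis j 1)) $ i)) (at 0)"
      by (rule bounded_linear.has_derivative[OF bounded_linear_vec_nth])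
    moreover have "(jacobian h (at x) *v (t *\<^sub>R axis j 1)) $ i = jacobian h (at x) $ i $ j * t" for t
      by (simp add: matrix_vector_mult_scaleR matrix_vector_mult_basis column_def)
    ultimately have "((\<lambda>t::real. h (x + t *\<^sub>R axis j 1) $ i) has_field_derivative
        jacobian h (at x) $ i $ j) (at 0)"
      by (simp add: has_field_derivative_def)
    then show ?thesis
      unfolding partial_deriv_def by (rule DERIV_imp_deriv)
  qed
  then show ?thesis
    by (simp add: jacobian_matrix_def vec_eq_iff)
qed

definition projector_onto_kernel :: "real^'n^'n \<Rightarrow> real^'n^'n \<Rightarrow> bool" where
  "projector_onto_kernel E Q \<longleftrightarrow> Q ** Q = Q \<and> range ((*v) Q) = {x. E *v x = 0}"

definition tractability_index_one :: "('n::finite, 'm::finite) dae_system \<Rightarrow> bool" where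
  "tractability_index_one S \<longleftrightarrow> (\<forall>Q. projector_onto_kernel (dae_E S) Q \<longrightarrow>
     (\<forall>x. invertible (dae_E S - jacobian_matrix (\<lambda>y. dae_A S y *v y) x ** Q)))"

definition reduced_system :: "('n1::finite, 'n2::finite, 'nf::finite, 'm::finite) mqs \<Rightarrow>
    real^'r::finite^'n2 \<Rightarrow> ('n1 + 'r, 'm) dae_system" where
  "reduced_system P Y = (let Ri = matrix_inv (Res P); Yt = transpose Y in
     \<lparr> dae_E = block_matrix
         (M_11 P + X_1 P ** Ri ** transpose (X_1 P)) (X_1 P ** Ri ** transpose (X_2 P) ** Y)
         (Yt ** X_2 P ** Ri ** transpose (X_1 P)) (Yt ** X_2 P ** Ri ** transpose (X_2 P) ** Y),
       dae_A = (\<lambda>x. - block_matrix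
         (K_11 P (vec_upper x)) (K_12 P ** Y)
         (Yt ** K_21 P) (Yt ** K_22 P ** Y)),
       dae_B = vstack (X_1 P) (Yt ** X_2 P) ** Ri,
       dae_D = Ri \<rparr>)"

end

theory Submission
  imports Defs
begin

text \<open>Write \<open>z = [a, b]\<close> for a state and \<open>u(z) = X\<^sub>1\<^sup>T a + X\<^sub>2\<^sup>T Y b\<close>.  The matrix \<open>E\<close> is the Gram-type
  form \<open>z \<bullet> E z' = a \<bullet> M\<^sub>1\<^sub>1 a' + u(z) \<bullet> R\<^sup>-\<^sup>1 u(z')\<close>.  As \<open>M\<^sub>1\<^sub>1\<close> and \<open>R\<^sup>-\<^sup>1\<close> are positive definite, \<open>E z = 0\<close>
  forces \<open>a = 0\<close> and \<open>u(z) = 0\<close>, and conversely such a \<open>z\<close> is orthogonal to the range of \<open>E\<close>.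

  In a direction \<open>z = [0, b]\<close> the nonlinearity does not move: \<open>A\<close> depends on the upper part of the
  state only, so \<open>A(x) x\<close> is affine along \<open>z\<close> and the columns of the Jacobian that act on the kernel
  are those of \<open>A(x)\<close>, whether or not \<open>K\<^sub>1\<^sub>1(a\<^sub>1) a\<^sub>1\<close> is differentiable.  Hence
  \<open>z \<bullet> J z = - (Y b) \<bullet> K\<^sub>2\<^sub>2 (Y b) = - (C\<^sub>2 Y b) \<bullet> M\<^sub>\<nu>(0) (C\<^sub>2 Y b)\<close>.  If this vanishes, then
  \<open>C\<^sub>2 Y b = 0\<close>; but \<open>Y b\<close> lies in the range of \<open>C\<^sub>2\<^sup>T\<close>, the orthogonal complement of the kernel of
  \<open>C\<^sub>2\<close>, so \<open>Y b = 0\<close> and \<open>b = 0\<close>.  These two facts about the kernel of \<open>E\<close> give invertibility of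
  \<open>E - J Q\<close> for every projector \<open>Q\<close> onto it (\<open>index_one_criterion\<close>).

  The factorization \<open>K\<^sub>2\<^sub>2 = C\<^sub>2\<^sup>T M\<^sub>\<nu>(0) C\<^sub>2\<close> follows from the definitions (\<open>K_22_factorization\<close>).  Since
  \<open>K\<^sub>2\<^sub>2\<close> is read off the stiffness matrix at \<open>0\<close>, only the linear problem with reluctivity \<open>\<nu>(\<xi>, 0)\<close>
  enters.  The core is that inside each tetrahedron the curl of an edge function is the
  combination of face functions that \<open>C_d\<close> prescribes (\<open>curl_phi_e\<close>).  It reduces to an identity
  between barycentric coordinates: the two faces of the tetrahedron that meet at the edge
  contribute, and their sum collapses because the coordinates add up to \<open>1\<close> and their gradients
  to \<open>0\<close>.\<close>


section \<open>A criterion for invertibility\<close>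

text \<open>If \<open>(E - J Q) w = 0\<close>, put \<open>z = Q w\<close>, which lies in the kernel of \<open>E\<close>.  Testing \<open>E w = J z\<close> with
  \<open>z\<close> makes the left-hand side vanish, so \<open>z = 0\<close>; then \<open>E w = 0\<close>, and \<open>Q\<close> fixes \<open>w\<close>, so that
  \<open>w = Q w = 0\<close>.\<close>

lemma index_one_criterion:
  fixes E J Q :: "real^'n^'n"
  assumes Q: "projector_onto_kernel E Q"
    and range_E: "\<And>z w. E *v z = 0 \<Longrightarrow> z \<bullet> (E *v w) = 0"
    and J: "\<And>z. E *v z = 0 \<Longrightarrow> z \<bullet> (J *v z) = 0 \<Longrightarrow> z = 0"
  shows "invertible (E - J ** Q)"
proof -
  have "w = 0" if w: "(E - J ** Q) *v w = 0" for w
  proof -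
    let ?z = "Q *v w"
    have Ez: "E *v ?z = 0"
      using Q by (auto simp: projector_onto_kernel_def)
    have Ew: "E *v w = J *v ?z"
      using w by (simp add: matrix_vector_mult_diff_rdistrib matrix_vector_mul_assoc)
    have z: "?z = 0"
      using J[OF Ez] range_E[OF Ez, of w] Ew by simp
    then have "w \<in> range ((*v) Q)"
      using Q Ew by (simp add: projector_onto_kernel_def)
    then obtain u where u: "w = Q *v u" by blast
    have "Q *v w = w"
      using Q unfolding u projector_onto_kernel_def by (simp add: matrix_vector_mul_assoc)
    then show "w = 0" using z by simp
  qed
  then show ?thesis
    by (simp add: invertible_left_inverse matrix_left_invertible_ker)
qed

text \<open>Along a coordinate in which \<open>A\<close> is constant, \<open>A(x) x\<close> is affine.  The partial derivative
  therefore exists without any smoothness of \<open>A\<close> in the other coordinates.\<close>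

lemma jacobian_matrix_column:
  fixes A :: "real^'n \<Rightarrow> real^'n^'k"
  assumes "\<And>t. A (x + t *\<^sub>R axis j 1) = A x"
  shows "jacobian_matrix (\<lambda>y. A y *v y) x $ i $ j = A x $ i $ j"
proof -
  have "(A (x + t *\<^sub>R axis j 1) *v (x + t *\<^sub>R axis j 1)) $ i = (A x *v x) $ i + t * A x $ i $ j" for t
    by (simp add: assms matrix_vector_right_distrib matrix_vector_mult_scaleR
        matrix_vector_mult_basis column_def)
  then have "partial_deriv j (\<lambda>y. (A y *v y) $ i) x = deriv (\<lambda>t. (A x *v x) $ i + t * A x $ i $ j) 0"
    by (simp add: partial_deriv_def)
  also have "\<dots> = A x $ i $ j"
    by (rule DERIV_imp_deriv) (auto intro!: derivative_eq_intros)
  finally show ?thesis by (simp add: jacobian_matrix_def)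
qed


section \<open>Block vectors and definite matrices\<close>

definition vec_lower :: "real^('a::finite + 'b::finite) \<Rightarrow> real^'b" where
  "vec_lower v = (\<chi> i. v $ Inr i)"

lemma sum_UNIV_Plus:
  fixes f :: "'a::finite + 'b::finite \<Rightarrow> 'c::comm_monoid_add"
  shows "sum f UNIV = (\<Sum>a\<in>UNIV. f (Inl a)) + (\<Sum>b\<in>UNIV. f (Inr b))"
  using sum.Plus[of "UNIV::'a set" "UNIV::'b set" f] by (simp add: comp_def)

lemma vec_append_upper_lower: "vec_append (vec_upper v) (vec_lower v) = v"
  by (auto simp: vec_append_def vec_upper_def vec_lower_def vec_eq_iff split: sum.split)

lemma vec_append_eq_0_iff: "vec_append a b = 0 \<longleftrightarrow> a = 0 \<and> b = 0"
  by (auto simp: vec_append_def vec_eq_iff split: sum.splits)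

lemma inner_vec_append: "vec_append a b \<bullet> vec_append c d = a \<bullet> c + b \<bullet> d"
  by (simp add: inner_vec_def sum_UNIV_Plus vec_append_def)

lemma block_matrix_vec_append:
  "block_matrix A B C D *v vec_append a b = vec_append (A *v a + B *v b) (C *v a + D *v b)"
  by (auto simp: vec_eq_iff matrix_vector_mult_def sum_UNIV_Plus block_matrix_def vec_append_def
      split: sum.split)

lemma inner_matrix_vector: "x \<bullet> (A *v y) = (transpose A *v x) \<bullet> y"
  for A :: "real^'n^'m"
  using dot_lmul_matrix[of x A y] by simp

lemma inj_matrix_of_independent_columns:
  fixes Y :: "real^'r^'n"
  assumes "inj (\<lambda>j. column j Y)" "independent (columns Y)" and v: "Y *v v = 0"
  shows "v = 0"
proof -
  have cols: "columns Y = range (\<lambda>j. column j Y)"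
    by (auto simp: columns_def)
  let ?g = "the_inv (\<lambda>j. column j Y)"
  have "(\<Sum>c\<in>columns Y. v $ ?g c *\<^sub>R c) = (\<Sum>j\<in>UNIV. v $ j *\<^sub>R column j Y)"
    unfolding cols by (subst sum.reindex[OF assms(1)]) (simp add: the_inv_f_f[OF assms(1)])
  also have "\<dots> = Y *v v"
    by (simp add: matrix_mult_sum scalar_mult_eq_scaleR)
  finally have s: "(\<Sum>c\<in>columns Y. v $ ?g c *\<^sub>R c) = 0"
    using v by simp
  have fin: "finite (columns Y)"
    unfolding cols by simp
  have "v $ j = 0" for j
    using independentD[OF assms(2) fin subset_refl s, of "column j Y"]
    by (simp add: cols the_inv_f_f[OF assms(1)])
  then show ?thesis by (simp add: vec_eq_iff)
qed

lemma spd_inner_nonneg: "spd A \<Longrightarrow> 0 \<le> x \<bullet> (A *v x)"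
  by (cases "x = 0") (auto simp: spd_def dest: less_imp_le)

lemma spd_inner_eq_0: "spd A \<Longrightarrow> x \<bullet> (A *v x) = 0 \<Longrightarrow> x = 0"
  by (metis less_irrefl spd_def)

lemma matrix_inv_spd_pos:
  assumes "spd A" "x \<noteq> 0"
  shows "0 < x \<bullet> (matrix_inv A *v x)"
proof -
  have "invertible A"
    unfolding invertible_left_inverse matrix_left_invertible_ker
    using spd_inner_eq_0[OF assms(1)] by (metis inner_zero_right)
  then have "A ** matrix_inv A = mat 1"
    unfolding invertible_def matrix_inv_def by (rule someI2_ex) simp
  then have x: "A *v (matrix_inv A *v x) = x"
    by (simp add: matrix_vector_mul_assoc)
  let ?y = "matrix_inv A *v x"
  have "?y \<noteq> 0" using x assms(2) by auto
  then have "0 < ?y \<bullet> (A *v ?y)" using assms(1) by (simp add: spd_def)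
  then show ?thesis by (simp add: x inner_commute)
qed


section \<open>Barycentric coordinates\<close>

lemma simplex_vertices:
  assumes "3 simplex T"
  shows "\<not> affine_dependent (vertices T)" "card (vertices T) = 4"
proof -
  obtain C where C: "\<not> affine_dependent C" "int (card C) = 3 + 1" "T = convex hull C"
    using assms by (auto simp: simplex)
  then have "vertices T = C"
    by (auto simp: vertices_def extreme_point_of_convex_hull_affine_independent)
  then show "\<not> affine_dependent (vertices T)" "card (vertices T) = 4"
    using C by auto
qed

lemma affine_differences_basis:
  fixes V :: "(real^3) set"
  assumes "\<not> affine_dependent V" "card V = 4" "p \<in> V"
  shows "independent ((\<lambda>v. v - p) ` (V - {p}))" "span ((\<lambda>v. v - p) ` (V - {p})) = UNIV"
proof -
  have eq: "(\<lambda>v. - p + v) = (\<lambda>v. v - p)" by auto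
  show i: "independent ((\<lambda>v. v - p) ` (V - {p}))"
    using assms(1) affine_dependent_iff_dependent2[OF assms(3)] by (simp add: eq)
  have "card ((\<lambda>v. v - p) ` (V - {p})) = 3"
    using assms by (subst card_image) (auto simp: inj_on_def)
  then show "span ((\<lambda>v. v - p) ` (V - {p})) = UNIV"
    using card_ge_dim_independent[OF subset_UNIV i] by auto
qed

lemma affine_function_zero:
  fixes V :: "(real^3) set"
  assumes V: "\<not> affine_dependent V" "card V = 4" and z: "\<And>v. v \<in> V \<Longrightarrow> g \<bullet> v + c = 0"
  shows "g = 0" "c = 0"
proof -
  have "V \<noteq> {}" using V(2) by auto
  then obtain p where p: "p \<in> V" by blast
  have "orthogonal g x" if "x \<in> (\<lambda>v. v - p) ` (V - {p})" for x
    using that z p by (auto simp: orthogonal_def inner_diff_right) (metis add_right_imp_eq)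
  then have "orthogonal g g"
    using orthogonal_to_span[of g "(\<lambda>v. v - p) ` (V - {p})"] affine_differences_basis(2)[OF V p] by blast
  then show "g = 0" by (simp add: orthogonal_def)
  then show "c = 0" using z[OF p] by simp
qed

text \<open>Existence and uniqueness are what the definite description in the definition of \<open>bary_grad\<close>
  needs.\<close>

lemma affine_interpolation:
  fixes V :: "(real^3) set" and f :: "real^3 \<Rightarrow> real"
  assumes V: "\<not> affine_dependent V" "card V = 4"
  shows "\<exists>!g. \<exists>c. \<forall>v\<in>V. g \<bullet> v + c = f v"
proof (rule ex_ex1I)
  have "V \<noteq> {}" using V(2) by auto
  then obtain p where p: "p \<in> V" by blast
  obtain h where h: "linear h" "\<And>x. x \<in> (\<lambda>v. v - p) ` (V - {p}) \<Longrightarrow> h x = f (x + p) - f p"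
    using linear_independent_extend[OF affine_differences_basis(1)[OF V p], of "\<lambda>x. f (x + p) - f p"]
    by blast
  have "adjoint h 1 \<bullet> v + (f p - adjoint h 1 \<bullet> p) = f v" if "v \<in> V" for v
  proof -
    have "h (v - p) = f v - f p"
      using h(2)[of "v - p"] that linear_0[OF h(1)] by (cases "v = p") auto
    moreover have "adjoint h 1 \<bullet> (v - p) = h (v - p)"
      using adjoint_works[OF h(1), of "v - p" 1] by (simp add: inner_commute)
    ultimately show ?thesis by (simp add: inner_diff_right)
  qed
  then show "\<exists>g c. \<forall>v\<in>V. g \<bullet> v + c = f v" by blast
next
  fix g g' assume "\<exists>c. \<forall>v\<in>V. g \<bullet> v + c = f v" "\<exists>c. \<forall>v\<in>V. g' \<bullet> v + c = f v"
  then obtain c c' where c: "\<And>v. v \<in> V \<Longrightarrow> g \<bullet> v + c = f v" "\<And>v. v \<in> V \<Longrightarrow> g' \<bullet> v + c' = f v"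
    by blast
  have "(g - g') \<bullet> v + (c - c') = 0" if "v \<in> V" for v
    using c[OF that] by (simp add: inner_diff_left)
  then show "g = g'" using affine_function_zero(1)[OF V] by (metis right_minus_eq)
qed

context
  fixes T :: "(real^3) set"
  assumes T: "3 simplex T"
begin

lemma bary_vertex:
  assumes "p \<in> vertices T" "v \<in> vertices T"
  shows "bary T p v = of_bool (v = p)"
proof -
  have "\<exists>c. \<forall>v\<in>vertices T. bary_grad T p \<bullet> v + c = of_bool (v = p)"
    unfolding bary_grad_def
    by (rule theI'[OF affine_interpolation[OF simplex_vertices[OF T]]])
  then obtain c where c: "\<And>v. v \<in> vertices T \<Longrightarrow> bary_grad T p \<bullet> v + c = of_bool (v = p)"
    by blast
  show ?thesis
    using c[OF assms(1)] c[OF assms(2)] by (simp add: bary_def inner_diff_right)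
qed

text \<open>The sum of the coordinates is an affine function with value \<open>1\<close> at all four vertices, hence
  it is the constant \<open>1\<close>.\<close>

lemma bary_partition_of_unity:
  shows "(\<Sum>p\<in>vertices T. bary_grad T p) = 0" "(\<Sum>p\<in>vertices T. bary T p x) = 1"
proof -
  let ?g = "\<Sum>p\<in>vertices T. bary_grad T p" and ?c = "(\<Sum>p\<in>vertices T. 1 - bary_grad T p \<bullet> p) - 1"
  have b: "(\<Sum>p\<in>vertices T. bary T p y) = ?g \<bullet> y + ?c + 1" for y
    by (simp add: bary_def inner_diff_right inner_sum_left sum.distrib sum_subtractf)
  have fin: "finite (vertices T)"
    using simplex_vertices(2)[OF T] by (simp add: card_ge_0_finite)
  have *: "?g \<bullet> v + ?c = 0" if v: "v \<in> vertices T" for v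
  proof -
    have "(\<Sum>p\<in>vertices T. bary T p v) = (\<Sum>p\<in>vertices T. of_bool (v = p))"
      by (rule sum.cong) (simp_all add: bary_vertex v)
    also have "\<dots> = 1"
      using v fin by (simp add: of_bool_def sum.delta)
    finally show ?thesis using b[of v] by simp
  qed
  show "?g = 0" by (rule affine_function_zero(1)[OF simplex_vertices[OF T] *])
  moreover have "?c = 0" by (rule affine_function_zero(2)[OF simplex_vertices[OF T] *])
  ultimately show "(\<Sum>p\<in>vertices T. bary T p x) = 1"
    using b[of x] by simp
qed

end


section \<open>The curl of the edge functions\<close>

text \<open>The affine fields that the edge and face functions are on the interior of a single
  tetrahedron, without the cut-off.\<close>

definition whitney_edge :: "(real^3) set \<Rightarrow> real^3 \<Rightarrow> real^3 \<Rightarrow> real^3 \<Rightarrow> real^3" where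
  "whitney_edge T p q x = bary T p x *\<^sub>R bary_grad T q - bary T q x *\<^sub>R bary_grad T p"

definition whitney_face :: "(real^3) set \<Rightarrow> real^3 \<Rightarrow> real^3 \<Rightarrow> real^3 \<Rightarrow> real^3 \<Rightarrow> real^3" where
  "whitney_face T p q r x = 2 *\<^sub>R
       (bary T p x *\<^sub>R cross3 (bary_grad T q) (bary_grad T r) +
        bary T q x *\<^sub>R cross3 (bary_grad T r) (bary_grad T p) +
        bary T r x *\<^sub>R cross3 (bary_grad T p) (bary_grad T q))"

lemma partial_deriv_affine: "partial_deriv i (\<lambda>y. c + d \<bullet> y) x = d $ i"
proof -
  have "(\<lambda>t. c + d \<bullet> (x + t *\<^sub>R axis i 1)) = (\<lambda>t. (c + d \<bullet> x) + t * d $ i)"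
    by (auto simp: inner_add_right inner_axis algebra_simps)
  then show ?thesis
    unfolding partial_deriv_def
    by simp (rule DERIV_imp_deriv, auto intro!: derivative_eq_intros)
qed

text \<open>The product rule \<open>curl (\<phi> g) = \<nabla>\<phi> \<times> g\<close> for a constant vector \<open>g\<close>, applied to both terms.\<close>

lemma curl_whitney_edge:
  "curl (whitney_edge T p q) x = 2 *\<^sub>R cross3 (bary_grad T p) (bary_grad T q)"
proof -
  have "(\<lambda>y. whitney_edge T p q y $ k) = (\<lambda>y.
      ((1 - bary_grad T p \<bullet> p) * bary_grad T q $ k - (1 - bary_grad T q \<bullet> q) * bary_grad T p $ k) +
      (bary_grad T q $ k *\<^sub>R bary_grad T p - bary_grad T p $ k *\<^sub>R bary_grad T q) \<bullet> y)" for k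
    by (simp add: whitney_edge_def bary_def inner_diff_right inner_diff_left algebra_simps)
  then have d: "partial_deriv i (\<lambda>y. whitney_edge T p q y $ k) x =
      bary_grad T q $ k * bary_grad T p $ i - bary_grad T p $ k * bary_grad T q $ i" for i k
    by (simp only: partial_deriv_affine) simp
  show ?thesis
    by (simp add: curl_def d cross3_def vec_eq_iff forall_3 algebra_simps)
qed

lemma whitney_face_rotate: "whitney_face T q r p x = whitney_face T p q r x"
  by (simp add: whitney_face_def algebra_simps)

lemma whitney_face_swap: "whitney_face T q p r x = - whitney_face T p q r x"
  by (simp add: whitney_face_def cross3_def vec_eq_iff forall_3 algebra_simps)

text \<open>The face field is alternating in its vertices, and \<open>incidence\<close> is the sign of the orientation
  of the face relative to the edge \<open>p \<rightarrow> q\<close>.  The product is therefore the same for all six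
  orderings of the vertices.\<close>

lemma whitney_face_incidence:
  assumes "distinct [p, q, r]" "{a, b, c} = {p, q, r}"
  shows "incidence (a, b, c) (p, q) *\<^sub>R whitney_face T a b c x = whitney_face T p q r x"
proof -
  have abc: "a = p \<or> a = q \<or> a = r" "b = p \<or> b = q \<or> b = r" "c = p \<or> c = q \<or> c = r"
    and pqr: "p \<in> {a, b, c}" "q \<in> {a, b, c}" "r \<in> {a, b, c}"
    using assms(2) by auto
  have "a \<noteq> b" "b \<noteq> c" "a \<noteq> c"
    using pqr assms(1) by auto
  with abc consider "a = p" "b = q" "c = r" | "a = q" "b = r" "c = p" | "a = r" "b = p" "c = q"
    | "a = q" "b = p" "c = r" | "a = p" "b = r" "c = q" | "a = r" "b = q" "c = p"
    by auto
  then show ?thesis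
  proof cases
    case 1 then show ?thesis by (simp add: incidence_def)
  next
    case 2 then show ?thesis
      using assms(1) by (simp add: incidence_def whitney_face_rotate[of T q r p])
  next
    case 3 then show ?thesis
      using assms(1) by (simp add: incidence_def whitney_face_rotate[of T r p q] whitney_face_rotate[of T q r p])
  next
    case 4 then show ?thesis
      using assms(1) by (simp add: incidence_def whitney_face_swap[of T q p r])
  next
    case 5 then show ?thesis
      using assms(1) by (simp add: incidence_def whitney_face_swap[of T p r q]
        whitney_face_rotate[of T r p q] whitney_face_rotate[of T q r p])
  next
    case 6 then show ?thesis
      using assms(1) by (simp add: incidence_def whitney_face_swap[of T r q p]
        whitney_face_rotate[of T q r p])
  qed
qed

lemma incidence_0:
  assumes "\<not> {p, q} \<subseteq> {a, b, c}"
  shows "incidence (a, b, c) (p, q) = 0"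
  using assms by (auto simp: incidence_def)

text \<open>With \<open>\<lambda>\<close> the barycentric coordinates, eliminating \<open>\<lambda>\<^sub>s\<close> and \<open>\<nabla>\<lambda>\<^sub>s\<close> by the partition of unity turns
  the sum over the two faces at the edge into
  \<open>2 (\<lambda>\<^sub>p + \<lambda>\<^sub>q + \<lambda>\<^sub>r + \<lambda>\<^sub>s) \<nabla>\<lambda>\<^sub>p \<times> \<nabla>\<lambda>\<^sub>q = 2 \<nabla>\<lambda>\<^sub>p \<times> \<nabla>\<lambda>\<^sub>q\<close>.\<close>

lemma whitney_face_sum:
  assumes T: "3 simplex T" and V: "vertices T = {p, q, r, s}" "distinct [p, q, r, s]"
  shows "whitney_face T p q r x + whitney_face T p q s x = curl (whitney_edge T p q) x"
proof -
  have g: "bary_grad T s = - bary_grad T p - bary_grad T q - bary_grad T r"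
    using bary_partition_of_unity(1)[OF T] V by (simp add: eq_neg_iff_add_eq_0 algebra_simps)
  have b: "bary T s x = 1 - bary T p x - bary T q x - bary T r x"
    using bary_partition_of_unity(2)[OF T, of x] V by simp
  show ?thesis
    unfolding curl_whitney_edge whitney_face_def g b
    by (simp add: cross3_def vec_eq_iff forall_3 algebra_simps)
qed


text \<open>The interiors of the tetrahedra are disjoint, so a point sees one summand at most.\<close>

lemma disjoint_indicator_sum:
  assumes P: "mqs_setting P" and T: "T \<in> mesh P" "x \<in> interior T"
  shows "(\<Sum>T' | T' \<in> mesh P \<and> Q T'. indicat_real (interior T') x *\<^sub>R f T') =
    (if Q T then f T else (0::'a::real_vector))"
proof -
  have "(\<Sum>T' | T' \<in> mesh P \<and> Q T'. indicat_real (interior T') x *\<^sub>R f T') =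
      (\<Sum>T' | T' \<in> mesh P \<and> Q T'. if T' = T then f T else 0)"
    using interior_unique[OF P T(1) _ T(2)] T(2)
    by (intro sum.cong) (auto simp: indicator_def split: if_splits)
  also have "\<dots> = (if Q T then f T else 0)"
    using mesh_facts(3)[OF P] T(1) by (subst sum.delta) auto
  finally show ?thesis .
qed

lemma phi_e_interior:
  assumes "mqs_setting P" "T \<in> mesh P" "x \<in> interior T" "edge P j = (p, q)"
  shows "phi_e P j x = (if {p, q} \<subseteq> vertices T then whitney_edge T p q x else 0)"
  unfolding phi_e_def edge_function_def assms(4) prod.case whitney_edge_def
  by (rule disjoint_indicator_sum[OF assms(1-3)])

lemma phi_f_interior:
  assumes "mqs_setting P" "T \<in> mesh P" "x \<in> interior T" "face P k = (a, b, c)"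
  shows "phi_f P k x = (if {a, b, c} \<subseteq> vertices T then whitney_face T a b c x else 0)"
  unfolding phi_f_def face_function_def assms(4) prod.case whitney_face_def
  by (rule disjoint_indicator_sum[OF assms(1-3)])

lemma edge_endpoints_distinct:
  assumes "mqs_setting P" "edge P j = (p, q)"
  shows "p \<noteq> q"
proof -
  have "mqs_mesh P"
    using assms(1) by (simp add: mqs_setting_def)
  then have b: "bij_betw (\<lambda>j. edge_set (edge P j)) UNIV
       {S. \<exists>p q. S = {p, q} \<and> p \<noteq> q \<and> (\<exists>T \<in> mesh P. {p, q} \<subseteq> vertices T) \<and>
           H0_curl (Om P) (edge_function (mesh P) (p, q))}"
    unfolding mqs_mesh_def by (elim conjE)
  obtain p' q' where "edge_set (edge P j) = {p', q'}" "p' \<noteq> q'"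
    using bij_betw_apply[OF b, of j] by blast
  then show ?thesis
    by (auto simp: assms(2) edge_set_def doubleton_eq_iff)
qed

lemma faces_bij:
  assumes "mqs_setting P"
  shows "bij_betw (\<lambda>k. face_set (face P k)) UNIV {S. card S = 3 \<and> (\<exists>T \<in> mesh P. S \<subseteq> vertices T)}"
proof -
  have "mqs_mesh P"
    using assms by (simp add: mqs_setting_def)
  then show ?thesis
    unfolding mqs_mesh_def by (elim conjE)
qed

text \<open>Among all faces of the mesh, only those of \<open>T\<close> that contain both end points of the edge
  contribute at \<open>x\<close>.  If the edge belongs to \<open>T\<close>, there are exactly two of them, and
  \<open>whitney_face_sum\<close> applies; otherwise there are none, and both sides vanish.\<close>

lemma curl_phi_e:
  assumes P: "mqs_setting P" and T: "T \<in> mesh P" "x \<in> interior T"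
  shows "curl (phi_e P j) x = (\<Sum>k\<in>UNIV. C_d P $ k $ j *\<^sub>R phi_f P k x)"
proof -
  obtain p q where e: "edge P j = (p, q)" by fastforce
  have pq: "p \<noteq> q" by (rule edge_endpoints_distinct[OF P e])
  let ?V = "vertices T"
  let ?c = "\<lambda>k. C_d P $ k $ j *\<^sub>R phi_f P k x"
  \<comment> \<open>incidence kills the faces that miss the edge, the cut-off those outside \<open>T\<close>\<close>
  have face: "?c k = (if {p, q} \<subseteq> face_set (face P k) \<and> face_set (face P k) \<subseteq> ?V then ?c k else 0)" for k
  proof -
    obtain a b c where f: "face P k = (a, b, c)" by (metis prod_cases3)
    show ?thesis
      using incidence_0[of p q a b c] by (auto simp: C_d_def phi_f_interior[OF P T f] e f face_set_def)
  qed
  show ?thesis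
  proof (cases "{p, q} \<subseteq> ?V")
    case False
    have "curl (phi_e P j) x = curl (\<lambda>x. 0) x"
      by (rule curl_cong_open[OF open_interior T(2)])
        (use False in \<open>auto simp: phi_e_interior[OF P T(1) _ e]\<close>)
    moreover have "?c k = 0" for k
      using False by (subst face) auto
    ultimately show ?thesis by (simp del: scaleR_eq_0_iff)
  next
    case True
    have s: "3 simplex T" by (rule mesh_facts(4)[OF P T(1)])
    have "card (?V - {p, q}) = 2"
      using simplex_vertices(2)[OF s] True pq by (subst card_Diff_subset) auto
    then obtain r t where rt: "?V - {p, q} = {r, t}" "r \<noteq> t"
      by (auto simp: card_2_iff)
    then have V: "?V = {p, q, r, t}" and dist: "distinct [p, q, r, t]"
      using True pq by auto
    have ex: "\<exists>k. face_set (face P k) = {p, q, u}" if "u \<in> {r, t}" for u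
    proof -
      have "{p, q, u} \<in> {S. card S = 3 \<and> (\<exists>T \<in> mesh P. S \<subseteq> vertices T)}"
        using that dist V T(1) by auto
      then have "{p, q, u} \<in> range (\<lambda>k. face_set (face P k))"
        by (simp only: bij_betw_imp_surj_on[OF faces_bij[OF P]])
      then show ?thesis by (elim rangeE) (rule exI, rule sym)
    qed
    obtain k1 where k1: "face_set (face P k1) = {p, q, r}" using ex by blast
    obtain k2 where k2: "face_set (face P k2) = {p, q, t}" using ex by blast
    have own_face: "?c k = whitney_face T p q u x"
      if k: "face_set (face P k) = {p, q, u}" and u: "u \<in> {r, t}" for k u
    proof -
      obtain a b c where f: "face P k = (a, b, c)" by (metis prod_cases3)
      then have abc: "{a, b, c} = {p, q, u}" using k by (simp add: face_set_def)
      have "distinct [p, q, u]" using dist u by auto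
      moreover have "{a, b, c} \<subseteq> ?V" unfolding abc V using u by auto
      ultimately show ?thesis
        using whitney_face_incidence[OF _ abc, of T x]
        by (simp add: C_d_def e f phi_f_interior[OF P T f])
    qed
    have others: "?c k = 0" if k: "k \<notin> {k1, k2}" for k
    proof (rule ccontr)
      let ?S = "face_set (face P k)"
      assume "?c k \<noteq> 0"
      then have S: "{p, q} \<subseteq> ?S" "?S \<subseteq> ?V" using face[of k] by metis+
      have "card ?S = 3"
        using bij_betw_apply[OF faces_bij[OF P], of k] by simp
      then have "card (?S - {p, q}) = 1"
        using S pq by (subst card_Diff_subset) auto
      then obtain u where "?S - {p, q} = {u}" by (auto simp: card_1_singleton_iff)
      then have u: "?S = {p, q, u}" "u \<in> {r, t}"
        using S V by auto
      then have "?S = face_set (face P k1) \<or> ?S = face_set (face P k2)"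
        using k1 k2 by auto
      then show False
        using k bij_betw_imp_inj_on[OF faces_bij[OF P]] by (auto dest: injD)
    qed
    have "k1 \<noteq> k2" using k1 k2 dist by auto
    have "(\<Sum>k\<in>UNIV. ?c k) = (\<Sum>k\<in>{k1, k2}. ?c k)"
      by (rule sum.mono_neutral_right) (use others in auto)
    also have "\<dots> = whitney_face T p q r x + whitney_face T p q t x"
      using \<open>k1 \<noteq> k2\<close> own_face[OF k1] own_face[OF k2] by simp
    also have "\<dots> = curl (whitney_edge T p q) x"
      by (rule whitney_face_sum[OF s V dist])
    also have "\<dots> = curl (phi_e P j) x"
      by (rule curl_cong_open[OF open_interior T(2)])
        (use True in \<open>simp add: phi_e_interior[OF P T(1) _ e]\<close>)
    finally show ?thesis by simp
  qed
qed


section \<open>Factorization of the stiffness matrix\<close>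

lemma phi_f_measurable: "phi_f P k \<in> borel_measurable borel"
proof -
  obtain a b c where f: "face P k = (a, b, c)" by (metis prod_cases3)
  have [measurable]: "bary T p \<in> borel_measurable borel" for T p
    unfolding bary_def by (intro borel_measurable_continuous_onI continuous_intros)
  show ?thesis
    unfolding phi_f_def face_function_def f prod.case by measurable
qed

lemma phi_f_bounded:
  assumes "bounded S"
  obtains B where "\<And>x. x \<in> S \<Longrightarrow> norm (phi_f P k x) \<le> B"
proof -
  obtain a b c where f: "face P k = (a, b, c)" by (metis prod_cases3)
  have "\<exists>B. \<forall>x\<in>S. norm (whitney_face T a b c x) \<le> B" for T
  proof -
    have "continuous_on (closure S) (whitney_face T a b c)"
      unfolding whitney_face_def[abs_def] bary_def by (intro continuous_intros)
    then have "bounded (whitney_face T a b c ` closure S)"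
      using assms by (intro compact_imp_bounded compact_continuous_image) auto
    then show ?thesis
      using closure_subset[of S] unfolding bounded_iff by blast
  qed
  then obtain B where B: "\<And>T x. x \<in> S \<Longrightarrow> norm (whitney_face T a b c x) \<le> B T"
    by metis
  have "norm (phi_f P k x) \<le> (\<Sum>T | T \<in> mesh P \<and> {a, b, c} \<subseteq> vertices T. B T)" if x: "x \<in> S" for x
    unfolding phi_f_def face_function_def f prod.case whitney_face_def[symmetric]
  proof (rule sum_norm_le)
    fix T
    show "norm (indicat_real (interior T) x *\<^sub>R whitney_face T a b c x) \<le> B T"
      using B[OF x, of T] norm_ge_zero[of "whitney_face T a b c x"]
      by (auto simp: indicator_def simp del: norm_ge_zero)
  qed
  then show thesis by (rule that)
qed

text \<open>At field strength \<open>0\<close> the reluctivity takes finitely many values and the face functions are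
  bounded on the bounded domain.  Integrability is needed to interchange integral and sum in the
  factorization below: the integral of a non-integrable function is \<open>0\<close> by convention and would not
  be additive.\<close>

lemma M_nu_0_integrable:
  assumes P: "mqs_setting P"
  shows "integrable (lebesgue_on (Om P)) (\<lambda>x. nu P x 0 * (phi_f P l x \<bullet> phi_f P k x))"
proof -
  have d: "mqs_domain (Om P) (OmC P)"
    using P by (simp add: mqs_setting_def)
  have Om: "bounded (Om P)" "open (Om P)" and OmC: "open (OmC P)"
    using d by (simp_all add: mqs_domain_def)
  have lm: "Om P \<in> lmeasurable"
    by (rule lmeasurable_open[OF Om])
  interpret finite_measure "lebesgue_on (Om P)"
    by (rule finite_measure_lebesgue_on[OF lm])
  obtain B where B: "\<And>x. x \<in> Om P \<Longrightarrow> norm (phi_f P l x) \<le> B" using phi_f_bounded[OF Om(1)] by blast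
  obtain B' where B': "\<And>x. x \<in> Om P \<Longrightarrow> norm (phi_f P k x) \<le> B'" using phi_f_bounded[OF Om(1)] by blast
  let ?N = "\<bar>nuC P 0\<bar> + \<bar>nuI P\<bar>"
  show ?thesis
  proof (rule integrable_const_bound[where B = "?N * (B * B')"])
    have "norm (nu P x 0 * (phi_f P l x \<bullet> phi_f P k x)) \<le> ?N * (B * B')" if x: "x \<in> Om P" for x
    proof -
      have "\<bar>nu P x 0\<bar> \<le> ?N" by (auto simp: nu_def indicator_def)
      moreover have "\<bar>phi_f P l x \<bullet> phi_f P k x\<bar> \<le> B * B'"
        using Cauchy_Schwarz_ineq2[of "phi_f P l x" "phi_f P k x"]
          mult_mono'[OF B[OF x] B'[OF x]] by simp
      ultimately show ?thesis
        by (simp add: abs_mult mult_mono')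
    qed
    then show "AE x in lebesgue_on (Om P). norm (nu P x 0 * (phi_f P l x \<bullet> phi_f P k x)) \<le> ?N * (B * B')"
      by (intro AE_I2) simp
    have [measurable]: "OmC P \<in> sets borel" "OmI P \<in> sets borel" "phi_f P i \<in> borel_measurable borel" for i
      using OmC Om by (auto simp: OmI_def phi_f_measurable)
    have "(\<lambda>x. nu P x 0 * (phi_f P l x \<bullet> phi_f P k x)) \<in> borel_measurable borel"
      unfolding nu_def by measurable
    then show "(\<lambda>x. nu P x 0 * (phi_f P l x \<bullet> phi_f P k x)) \<in> borel_measurable (lebesgue_on (Om P))"
      by (intro measurable_restrict_space1 measurable_completion) simp
  qed
qed

text \<open>Off the null set of faces of the mesh, \<open>curl_phi_e\<close> turns the integrand of the stiffness matrix
  into a combination of those of the mass matrix.\<close>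

lemma stiffness_0_factorization:
  fixes P :: "('n1::finite, 'n2::finite, 'nf::finite, 'm::finite) mqs"
  assumes P: "mqs_setting P"
  shows "stiffness P 0 = transpose (C_d P) ** M_nu P 0 ** C_d P"
proof -
  let ?I = "\<lambda>k l x. nu P x 0 * (phi_f P l x \<bullet> phi_f P k x)"
  have "stiffness P 0 $ i $ j = (transpose (C_d P) ** M_nu P 0 ** C_d P) $ i $ j" for i j
  proof -
    have "stiffness P 0 $ i $ j = (LINT x|lebesgue_on (Om P).
        (\<Sum>l\<in>UNIV. \<Sum>k\<in>UNIV. (C_d P $ k $ i * C_d P $ l $ j) * ?I k l x))"
      unfolding stiffness_def vec_lambda_beta
    proof (rule lebesgue_on_integral_cong[OF mesh_facts(1)[OF P] negligible_skeleton[OF P]])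
      fix x assume x: "x \<in> Om P - skeleton (mesh P)"
      obtain T where T: "T \<in> mesh P" "x \<in> interior T"
        using in_interior[OF P x] by blast
      show "nu P x (norm (curl (\<lambda>x. \<Sum>j\<in>UNIV. (0::real^('n1 + 'n2)) $ j *\<^sub>R phi_e P j x) x)) *
          (curl (phi_e P j) x \<bullet> curl (phi_e P i) x) =
        (\<Sum>l\<in>UNIV. \<Sum>k\<in>UNIV. (C_d P $ k $ i * C_d P $ l $ j) * ?I k l x)"
        by (subst sum.swap) (simp add: curl_phi_e[OF P T] inner_sum_left inner_sum_right sum_distrib_left mult_ac)
    qed
    also have "\<dots> = (\<Sum>l\<in>UNIV. \<Sum>k\<in>UNIV. (C_d P $ k $ i * C_d P $ l $ j) *
        (LINT x|lebesgue_on (Om P). ?I k l x))"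
      by (simp add: M_nu_0_integrable[OF P])
    also have "\<dots> = (transpose (C_d P) ** M_nu P 0 ** C_d P) $ i $ j"
      by (simp add: matrix_matrix_mult_def transpose_def M_nu_def sum_distrib_left mult_ac)
    finally show ?thesis .
  qed
  then show ?thesis by (simp add: vec_eq_iff)
qed

lemma K_22_factorization:
  assumes "mqs_setting P"
  shows "K_22 P = transpose (C_2 P) ** M_nu P 0 ** C_2 P"
  by (simp add: K_22_def stiffness_0_factorization[OF assms] submatrix_def C_2_def
      matrix_matrix_mult_def transpose_def vec_eq_iff)


section \<open>Tractability index one\<close>

theorem theorem5:
  fixes P :: "('n1::finite, 'n2::finite, 'nf::finite, 'm::finite) mqs"
    and Y :: "real^'r::finite^'n2"
  assumes "mqs_setting P"
    and "spd (M_11 P)"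
    and "\<forall>a. spd (M_nu P (C_d P *v a))"
    and "rank (X_2 P) = CARD('m)"
    and "CARD('r) = CARD('n2) - dim {v. C_2 P *v v = 0}"
    and "inj (\<lambda>j. column j Y)"
    and "independent (columns Y)"
    and "span (columns Y) = range ((*v) (transpose (C_2 P)))"
  shows "tractability_index_one (reduced_system P Y)"
  unfolding tractability_index_one_def
proof (intro allI impI)
  fix Q :: "real^('n1 + 'r)^('n1 + 'r)" and x :: "real^('n1 + 'r)"
  let ?S = "reduced_system P Y"
  let ?E = "dae_E ?S" and ?J = "jacobian_matrix (\<lambda>y. dae_A ?S y *v y) x"
  let ?Ri = "matrix_inv (Res P)"
  define u where "u a b = transpose (X_1 P) *v a + transpose (X_2 P) *v (Y *v b)" for a b
  have Res: "spd (Res P)"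
    using assms(1) by (simp add: mqs_setting_def mqs_coefficients_def)
  have M: "spd (M_nu P 0)"
    using assms(3)[rule_format, of 0] by simp

  have E: "vec_append a b \<bullet> (?E *v vec_append c d) = a \<bullet> (M_11 P *v c) + u a b \<bullet> (?Ri *v u c d)" for a b c d
    by (simp add: reduced_system_def Let_def block_matrix_vec_append inner_vec_append u_def
        matrix_vector_mult_add_rdistrib matrix_vector_right_distrib inner_add_left inner_add_right
        inner_matrix_vector flip: matrix_vector_mul_assoc del: transpose_matrix_vector)
  have kernel: "\<exists>b. z = vec_append 0 b \<and> u 0 b = 0" if z: "?E *v z = 0" for z
  proof -
    obtain a b where ab: "z = vec_append a b" by (metis vec_append_upper_lower)
    have "a \<bullet> (M_11 P *v a) + u a b \<bullet> (?Ri *v u a b) = 0"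
      using E[of a b a b] z by (simp add: ab)
    moreover have "0 \<le> a \<bullet> (M_11 P *v a)" by (rule spd_inner_nonneg[OF assms(2)])
    moreover have "u a b \<noteq> 0 \<Longrightarrow> 0 < u a b \<bullet> (?Ri *v u a b)" by (rule matrix_inv_spd_pos[OF Res])
    ultimately have "u a b = 0" "a \<bullet> (M_11 P *v a) = 0"
      by (cases "u a b = 0"; simp)+
    then show ?thesis
      using spd_inner_eq_0[OF assms(2)] ab by blast
  qed

  \<comment> \<open>the off-diagonal block \<open>K\<^sub>1\<^sub>2\<close> drops out against the zero upper part of the test vector\<close>
  have J: "vec_append 0 b \<bullet> (?J *v vec_append 0 b) = - ((C_2 P *v (Y *v b)) \<bullet> (M_nu P 0 *v (C_2 P *v (Y *v b))))" for b
  proof -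
    have "vec_upper (x + t *\<^sub>R axis (Inr j) 1) = vec_upper x" for t and j :: 'r
      by (simp add: vec_upper_def axis_def vec_eq_iff)
    then have "dae_A ?S (x + t *\<^sub>R axis (Inr j) 1) = dae_A ?S x" for t j
      by (simp add: reduced_system_def Let_def)
    then have "?J $ i $ Inr j = dae_A ?S x $ i $ Inr j" for i j
      by (rule jacobian_matrix_column)
    then have "?J *v vec_append 0 b = dae_A ?S x *v vec_append 0 b"
      by (simp add: matrix_vector_mult_def sum_UNIV_Plus vec_append_def vec_eq_iff)
    moreover have "(- A) *v v = - (A *v v)" for A :: "real^('n1 + 'r)^('n1 + 'r)" and v
      by (simp add: matrix_vector_mult_def vec_eq_iff sum_negf)
    ultimately show ?thesis
      by (simp add: reduced_system_def Let_def block_matrix_vec_append inner_vec_append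
          K_22_factorization[OF assms(1)] inner_matrix_vector
          flip: matrix_vector_mul_assoc del: transpose_matrix_vector)
  qed

  assume "projector_onto_kernel ?E Q"
  then show "invertible (?E - ?J ** Q)"
  proof (rule index_one_criterion)
    fix z w assume "?E *v z = 0"
    then obtain b where b: "z = vec_append 0 b" "u 0 b = 0" using kernel by blast
    show "z \<bullet> (?E *v w) = 0"
      using E[of 0 b "vec_upper w" "vec_lower w"] b by (simp add: vec_append_upper_lower)
  next
    fix z assume "?E *v z = 0" and zJ: "z \<bullet> (?J *v z) = 0"
    then obtain b where b: "z = vec_append 0 b" using kernel by blast
    have C: "C_2 P *v (Y *v b) = 0"
      using zJ J[of b] spd_inner_eq_0[OF M] by (simp add: b)
    have "Y *v b \<in> range ((*v) (transpose (C_2 P)))"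
      using matrix_vector_mult_in_columnspace[of Y b] assms(8) by simp
    then obtain v where v: "Y *v b = transpose (C_2 P) *v v" by blast
    \<comment> \<open>\<open>Y b\<close> lies in the range of \<open>C\<^sub>2\<^sup>T\<close> and in the kernel of \<open>C\<^sub>2\<close>, hence is orthogonal to itself\<close>
    have "(Y *v b) \<bullet> (Y *v b) = v \<bullet> (C_2 P *v (Y *v b))"
      by (subst v) (rule inner_matrix_vector[symmetric])
    then have "Y *v b = 0" using C by simp
    then have "b = 0" by (rule inj_matrix_of_independent_columns[OF assms(6,7)])
    then show "z = 0" by (simp add: b vec_append_eq_0_iff)
  qed
qed

end
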